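(* Let $\mathcal{C}$ be a monoidal category. Then the category $\mathsf{Maf}(\mathcal{C})$ is never pre-rigid.
   Context: A monoidal category $(\mathcal{C},\otimes,\mathbb{I})$ is (right) pre-rigid if for every object $X$ there are an object $X^*$ (a pre-dual of $X$) and a morphism $\mathrm{ev}_X:X^*\otimes X\to\mathbb{I}$ such that for every object $T$ the map $\mathrm{Hom}_{\mathcal{C}}(T,X^* )\to\mathrm{Hom}_{\mathcal{C}}(T\otimes X,\mathbb{I})$, $u\mapsto \mathrm{ev}_X\circ(u\otimes X)$, is bijective. Here $X$ also denotes the identity morphism of $X$. No braiding is assumed. The category $\mathsf{Maf}(\mathcal{C})$: an object is a pair $\underline{X}=(I,X_i)$ where $I$ is a set (possibly empty) and $X_i$ is an object of $\mathcal{C}$ for each $i\in I$. A morphism $(I,X_i)\to(J,Y_j)$ is a pair $(f,\phi_j)$ where $f:J\to I$ is a map and $\phi_j:X_{f(j)}\to Y_j$ is a morphism of $\mathcal{C}$ for each $j\in J$. (Equivalently, $\mathsf{Maf}(\mathcal{C})=\mathsf{Fam}(\mathcal{C}^{\mathrm{op}})^{\mathrm{op}}$, where $\mathsf{Fam}$ denotes the category of set-indexed families.) If $(\mathcal{C},\otimes,\mathbb{I})$ is monoidal, $\mathsf{Maf}(\mathcal{C})$ is monoidal with $(I,X_i)\otimes(J,Y_j)=(I\times J,X_i\otimes Y_j)$, $(f,\phi_j)\otimes(f',\phi'_{j'})=(f\times f',\phi_j\otimes\phi'_{j'})$, and unit object $(\{*\},\mathbb{I})$. *)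

theory Defs
  imports "HOL-Library.FuncSet"
begin

section \<open>Categories and monoidal categories\<close>

record ('o, 'm) category_data =
  Obj :: "'o set"
  Arr :: "'m set"
  Dom :: "'m \<Rightarrow> 'o"
  Cod :: "'m \<Rightarrow> 'o"
  Ident :: "'o \<Rightarrow> 'm"
  Comp :: "'m \<Rightarrow> 'm \<Rightarrow> 'm"  (infixl "\<cdot>\<index>" 75)

definition hom :: "('o, 'm, 'z) category_data_scheme \<Rightarrow> 'o \<Rightarrow> 'o \<Rightarrow> 'm set" where
  "hom C X Y = {f \<in> Arr C. Dom C f = X \<and> Cod C f = Y}"

locale category =
  fixes C :: "('o, 'm, 'z) category_data_scheme" (structure)
  assumes Dom_Obj: "f \<in> Arr C \<Longrightarrow> Dom C f \<in> Obj C"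
    and Cod_Obj: "f \<in> Arr C \<Longrightarrow> Cod C f \<in> Obj C"
    and Id_hom: "X \<in> Obj C \<Longrightarrow> Ident C X \<in> hom C X X"
    and Comp_hom: "\<lbrakk>f \<in> hom C X Y; g \<in> hom C Y Z\<rbrakk> \<Longrightarrow> g \<cdot> f \<in> hom C X Z"
    and Id_left: "f \<in> hom C X Y \<Longrightarrow> Ident C Y \<cdot> f = f"
    and Id_right: "f \<in> hom C X Y \<Longrightarrow> f \<cdot> Ident C X = f"
    and Comp_assoc: "\<lbrakk>f \<in> hom C W X; g \<in> hom C X Y; h \<in> hom C Y Z\<rbrakk>
      \<Longrightarrow> h \<cdot> (g \<cdot> f) = (h \<cdot> g) \<cdot> f"

definition is_iso :: "('o, 'm, 'z) category_data_scheme \<Rightarrow> 'o \<Rightarrow> 'o \<Rightarrow> 'm \<Rightarrow> bool" where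
  "is_iso C X Y f \<longleftrightarrow> f \<in> hom C X Y \<and>
     (\<exists>g \<in> hom C Y X. Comp C g f = Ident C X \<and> Comp C f g = Ident C Y)"

record ('o, 'm) monoidal_data = "('o, 'm) category_data" +
  tensor :: "'o \<Rightarrow> 'o \<Rightarrow> 'o"  (infixr "\<otimes>\<index>" 80)
  tensor_arr :: "'m \<Rightarrow> 'm \<Rightarrow> 'm"  (infixr "\<odot>\<index>" 80)
  unit_obj :: "'o"  ("\<I>\<index>")
  associator :: "'o \<Rightarrow> 'o \<Rightarrow> 'o \<Rightarrow> 'm"
  left_unitor :: "'o \<Rightarrow> 'm"
  right_unitor :: "'o \<Rightarrow> 'm"

locale monoidal_category = category C
  for C :: "('o, 'm, 'z) monoidal_data_scheme" (structure) +
  assumes tensor_Obj: "\<lbrakk>X \<in> Obj C; Y \<in> Obj C\<rbrakk> \<Longrightarrow> X \<otimes> Y \<in> Obj C"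
    and unit_Obj: "\<I> \<in> Obj C"
    and tensor_hom: "\<lbrakk>f \<in> hom C X X'; g \<in> hom C Y Y'\<rbrakk>
      \<Longrightarrow> f \<odot> g \<in> hom C (X \<otimes> Y) (X' \<otimes> Y')"
    and tensor_Id: "\<lbrakk>X \<in> Obj C; Y \<in> Obj C\<rbrakk> \<Longrightarrow> Ident C X \<odot> Ident C Y = Ident C (X \<otimes> Y)"
    and tensor_Comp: "\<lbrakk>f \<in> hom C X X'; f' \<in> hom C X' X''; g \<in> hom C Y Y'; g' \<in> hom C Y' Y''\<rbrakk>
      \<Longrightarrow> (f' \<cdot> f) \<odot> (g' \<cdot> g) = (f' \<odot> g') \<cdot> (f \<odot> g)"
    and associator_iso: "\<lbrakk>X \<in> Obj C; Y \<in> Obj C; Z \<in> Obj C\<rbrakk>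
      \<Longrightarrow> is_iso C ((X \<otimes> Y) \<otimes> Z) (X \<otimes> (Y \<otimes> Z)) (associator C X Y Z)"
    and associator_natural: "\<lbrakk>f \<in> hom C X X'; g \<in> hom C Y Y'; h \<in> hom C Z Z'\<rbrakk>
      \<Longrightarrow> associator C X' Y' Z' \<cdot> ((f \<odot> g) \<odot> h) = (f \<odot> (g \<odot> h)) \<cdot> associator C X Y Z"
    and left_unitor_iso: "X \<in> Obj C \<Longrightarrow> is_iso C (\<I> \<otimes> X) X (left_unitor C X)"
    and left_unitor_natural: "f \<in> hom C X X'
      \<Longrightarrow> left_unitor C X' \<cdot> (Ident C \<I> \<odot> f) = f \<cdot> left_unitor C X"
    and right_unitor_iso: "X \<in> Obj C \<Longrightarrow> is_iso C (X \<otimes> \<I>) X (right_unitor C X)"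
    and right_unitor_natural: "f \<in> hom C X X'
      \<Longrightarrow> right_unitor C X' \<cdot> (f \<odot> Ident C \<I>) = f \<cdot> right_unitor C X"
    and triangle: "\<lbrakk>X \<in> Obj C; Y \<in> Obj C\<rbrakk>
      \<Longrightarrow> (Ident C X \<odot> left_unitor C Y) \<cdot> associator C X \<I> Y = right_unitor C X \<odot> Ident C Y"
    and pentagon: "\<lbrakk>W \<in> Obj C; X \<in> Obj C; Y \<in> Obj C; Z \<in> Obj C\<rbrakk>
      \<Longrightarrow> (Ident C W \<odot> associator C X Y Z) \<cdot> (associator C W (X \<otimes> Y) Z \<cdot> (associator C W X Y \<odot> Ident C Z))
        = associator C W X (Y \<otimes> Z) \<cdot> associator C (W \<otimes> X) Y Z"

section \<open>Pre-rigidity\<close>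

definition is_pre_dual ::
    "('o, 'm, 'z) monoidal_data_scheme \<Rightarrow> 'o \<Rightarrow> 'o \<Rightarrow> 'm \<Rightarrow> bool" where
  "is_pre_dual C X X' ev \<longleftrightarrow> X' \<in> Obj C \<and> ev \<in> hom C (X' \<otimes>\<^bsub>C\<^esub> X) \<I>\<^bsub>C\<^esub> \<and>
     (\<forall>T \<in> Obj C. bij_betw (\<lambda>u. ev \<cdot>\<^bsub>C\<^esub> (u \<odot>\<^bsub>C\<^esub> Ident C X)) (hom C T X') (hom C (T \<otimes>\<^bsub>C\<^esub> X) \<I>\<^bsub>C\<^esub>))"

definition pre_rigid :: "('o, 'm, 'z) monoidal_data_scheme \<Rightarrow> bool" where
  "pre_rigid C \<longleftrightarrow> (\<forall>X \<in> Obj C. \<exists>X' ev. is_pre_dual C X X' ev)"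

section \<open>Index sets\<close>

text \<open>
  There is no type of all sets in HOL, so the index sets of families are taken from an arbitrary
  universe: a collection of subsets of some type of elements that contains the empty set and a
  singleton and is closed under binary cartesian products, with ordered pairs of elements again
  being elements. Models of set theory and Grothendieck universes are instances (take the sets of
  the universe as the elements); so are all subsets of any type that carries a pairing, as in
  \<open>full_universe\<close> below. These closure conditions are the ones that the definition of the
  monoidal category of families uses.
\<close>

record 'i universe_data =
  small :: "'i set set"
  pair :: "'i \<Rightarrow> 'i \<Rightarrow> 'i"
  proj1 :: "'i \<Rightarrow> 'i"
  proj2 :: "'i \<Rightarrow> 'i"
  point :: "'i"

definition prod_set :: "'i universe_data \<Rightarrow> 'i set \<Rightarrow> 'i set \<Rightarrow> 'i set" where
  "prod_set U I J = {pair U i j | i j. i \<in> I \<and> j \<in> J}"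

locale set_universe =
  fixes U :: "'i universe_data"
  assumes proj1_pair: "proj1 U (pair U i j) = i"
    and proj2_pair: "proj2 U (pair U i j) = j"
    and small_empty: "{} \<in> small U"
    and small_point: "{point U} \<in> small U"
    and small_prod: "\<lbrakk>I \<in> small U; J \<in> small U\<rbrakk> \<Longrightarrow> prod_set U I J \<in> small U"

datatype 'a elem = Point | Atom 'a | Pair (left: "'a elem") (right: "'a elem")

text \<open>A universe in which every set of elements of the type \<open>'a\<close> occurs, for an arbitrary
  type \<open>'a\<close>.\<close>

definition full_universe :: "'a elem universe_data" where
  "full_universe =
     \<lparr>small = UNIV, pair = Pair, proj1 = left, proj2 = right, point = Point\<rparr>"

lemma set_universe_full_universe: "set_universe full_universe"
  by unfold_locales (simp_all add: full_universe_def)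

section \<open>The category Maf\<close>

type_synonym ('i, 'o) family = "'i set \<times> ('i \<Rightarrow> 'o)"

text \<open>
  An arrow from \<open>(I, X)\<close> to \<open>(J, Y)\<close> is stored together with its domain and codomain;
  \<open>reindex\<close> is the map from \<open>J\<close> to \<open>I\<close> and \<open>component\<close> is the family of arrows indexed by
  \<open>J\<close>. Families and maps are extensional (\<open>undefined\<close> outside of the index set), so that
  HOL equality is the intended equality of objects and of arrows.
\<close>

datatype ('i, 'o, 'm) maf_arrow =
  Maf_Arrow (source: "('i, 'o) family") (target: "('i, 'o) family")
    (reindex: "'i \<Rightarrow> 'i") (component: "'i \<Rightarrow> 'm")

definition maf_obj :: "'i universe_data \<Rightarrow> ('o, 'm) monoidal_data \<Rightarrow> ('i, 'o) family set" where
  "maf_obj U C = {(I, X). I \<in> small U \<and> X \<in> I \<rightarrow>\<^sub>E Obj C}"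

definition maf_arr ::
    "'i universe_data \<Rightarrow> ('o, 'm) monoidal_data \<Rightarrow> ('i, 'o, 'm) maf_arrow set" where
  "maf_arr U C = {Maf_Arrow (I, X) (J, Y) f \<phi> | I X J Y f \<phi>.
     (I, X) \<in> maf_obj U C \<and> (J, Y) \<in> maf_obj U C \<and>
     f \<in> J \<rightarrow>\<^sub>E I \<and> \<phi> \<in> (\<Pi>\<^sub>E j\<in>J. hom C (X (f j)) (Y j))}"

definition maf_id :: "('o, 'm) monoidal_data \<Rightarrow> ('i, 'o) family \<Rightarrow> ('i, 'o, 'm) maf_arrow" where
  "maf_id C A = Maf_Arrow A A (\<lambda>i\<in>fst A. i) (\<lambda>i\<in>fst A. Ident C (snd A i))"

definition maf_comp :: "('o, 'm) monoidal_data \<Rightarrow>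
    ('i, 'o, 'm) maf_arrow \<Rightarrow> ('i, 'o, 'm) maf_arrow \<Rightarrow> ('i, 'o, 'm) maf_arrow" where
  "maf_comp C q p = Maf_Arrow (source p) (target q)
     (\<lambda>k\<in>fst (target q). reindex p (reindex q k))
     (\<lambda>k\<in>fst (target q). component q k \<cdot>\<^bsub>C\<^esub> component p (reindex q k))"

definition maf_tensor :: "'i universe_data \<Rightarrow> ('o, 'm) monoidal_data \<Rightarrow>
    ('i, 'o) family \<Rightarrow> ('i, 'o) family \<Rightarrow> ('i, 'o) family" where
  "maf_tensor U C A B = (prod_set U (fst A) (fst B),
     \<lambda>k\<in>prod_set U (fst A) (fst B). snd A (proj1 U k) \<otimes>\<^bsub>C\<^esub> snd B (proj2 U k))"

definition maf_tensor_arr :: "'i universe_data \<Rightarrow> ('o, 'm) monoidal_data \<Rightarrow>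
    ('i, 'o, 'm) maf_arrow \<Rightarrow> ('i, 'o, 'm) maf_arrow \<Rightarrow> ('i, 'o, 'm) maf_arrow" where
  "maf_tensor_arr U C p q =
     (let K = prod_set U (fst (target p)) (fst (target q)) in
      Maf_Arrow (maf_tensor U C (source p) (source q)) (maf_tensor U C (target p) (target q))
        (\<lambda>k\<in>K. pair U (reindex p (proj1 U k)) (reindex q (proj2 U k)))
        (\<lambda>k\<in>K. component p (proj1 U k) \<odot>\<^bsub>C\<^esub> component q (proj2 U k)))"

definition maf_unit :: "'i universe_data \<Rightarrow> ('o, 'm) monoidal_data \<Rightarrow> ('i, 'o) family" where
  "maf_unit U C = ({point U}, \<lambda>i\<in>{point U}. \<I>\<^bsub>C\<^esub>)"

text \<open>The structure isomorphisms are the evident ones. As arrows reindex contravariantly, the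
  associator reindexes along the map from \<open>I \<times> (J \<times> K)\<close> to \<open>(I \<times> J) \<times> K\<close>.\<close>

definition maf_associator :: "'i universe_data \<Rightarrow> ('o, 'm) monoidal_data \<Rightarrow>
    ('i, 'o) family \<Rightarrow> ('i, 'o) family \<Rightarrow> ('i, 'o) family \<Rightarrow> ('i, 'o, 'm) maf_arrow" where
  "maf_associator U C A B D =
     (let L = prod_set U (fst A) (prod_set U (fst B) (fst D)) in
      Maf_Arrow (maf_tensor U C (maf_tensor U C A B) D) (maf_tensor U C A (maf_tensor U C B D))
        (\<lambda>l\<in>L. pair U (pair U (proj1 U l) (proj1 U (proj2 U l))) (proj2 U (proj2 U l)))
        (\<lambda>l\<in>L. associator C (snd A (proj1 U l)) (snd B (proj1 U (proj2 U l)))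
                 (snd D (proj2 U (proj2 U l)))))"

definition maf_left_unitor :: "'i universe_data \<Rightarrow> ('o, 'm) monoidal_data \<Rightarrow>
    ('i, 'o) family \<Rightarrow> ('i, 'o, 'm) maf_arrow" where
  "maf_left_unitor U C A = Maf_Arrow (maf_tensor U C (maf_unit U C) A) A
     (\<lambda>i\<in>fst A. pair U (point U) i) (\<lambda>i\<in>fst A. left_unitor C (snd A i))"

definition maf_right_unitor :: "'i universe_data \<Rightarrow> ('o, 'm) monoidal_data \<Rightarrow>
    ('i, 'o) family \<Rightarrow> ('i, 'o, 'm) maf_arrow" where
  "maf_right_unitor U C A = Maf_Arrow (maf_tensor U C A (maf_unit U C)) A
     (\<lambda>i\<in>fst A. pair U i (point U)) (\<lambda>i\<in>fst A. right_unitor C (snd A i))"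

definition Maf :: "'i universe_data \<Rightarrow> ('o, 'm) monoidal_data \<Rightarrow>
    (('i, 'o) family, ('i, 'o, 'm) maf_arrow) monoidal_data" where
  "Maf U C =
     \<lparr>Obj = maf_obj U C,
      Arr = maf_arr U C,
      Dom = source,
      Cod = target,
      Ident = maf_id C,
      Comp = maf_comp C,
      tensor = maf_tensor U C,
      tensor_arr = maf_tensor_arr U C,
      unit_obj = maf_unit U C,
      associator = maf_associator U C,
      left_unitor = maf_left_unitor U C,
      right_unitor = maf_right_unitor U C\<rparr>"

section \<open>Maf is a monoidal category\<close>

locale maf = set_universe U + monoidal_category C
  for U :: "'i universe_data" and C :: "('o, 'm) monoidal_data"
begin

lemmas [simp] = proj1_pair proj2_pair

lemma Maf_simps [simp]:
  "Obj (Maf U C) = maf_obj U C" "Arr (Maf U C) = maf_arr U C"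
  "Dom (Maf U C) = source" "Cod (Maf U C) = target" "Ident (Maf U C) = maf_id C"
  "Comp (Maf U C) = maf_comp C" "tensor (Maf U C) = maf_tensor U C"
  "tensor_arr (Maf U C) = maf_tensor_arr U C" "unit_obj (Maf U C) = maf_unit U C"
  "associator (Maf U C) = maf_associator U C" "left_unitor (Maf U C) = maf_left_unitor U C"
  "right_unitor (Maf U C) = maf_right_unitor U C"
  by (simp_all add: Maf_def)

lemma in_hom_Maf: "p \<in> hom (Maf U C) A B \<longleftrightarrow>
   A \<in> maf_obj U C \<and> B \<in> maf_obj U C \<and> source p = A \<and> target p = B \<and>
   reindex p \<in> fst B \<rightarrow>\<^sub>E fst A \<and>
   component p \<in> (\<Pi>\<^sub>E j\<in>fst B. hom C (snd A (reindex p j)) (snd B j))"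
  by (cases p; cases A; cases B) (auto simp: hom_def maf_arr_def)

lemma Maf_homI:
  assumes "A \<in> maf_obj U C" "B \<in> maf_obj U C" "source p = A" "target p = B"
   "reindex p \<in> extensional (fst B)" "component p \<in> extensional (fst B)"
   "\<And>j. j \<in> fst B \<Longrightarrow> reindex p j \<in> fst A"
   "\<And>j. j \<in> fst B \<Longrightarrow> component p j \<in> hom C (snd A (reindex p j)) (snd B j)"
  shows "p \<in> hom (Maf U C) A B"
  unfolding in_hom_Maf using assms by (auto simp: PiE_def Pi_def)

lemma Maf_homD:
  assumes "p \<in> hom (Maf U C) A B"
  shows "A \<in> maf_obj U C" "B \<in> maf_obj U C" "source p = A" "target p = B"
   "\<And>j. j \<in> fst B \<Longrightarrow> reindex p j \<in> fst A"
   "\<And>j. j \<in> fst B \<Longrightarrow> component p j \<in> hom C (snd A (reindex p j)) (snd B j)"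
  using assms unfolding in_hom_Maf by (auto simp: PiE_def Pi_def)

lemma Maf_hom_eqI:
  assumes "p \<in> hom (Maf U C) A B" "q \<in> hom (Maf U C) A B"
   "\<And>j. j \<in> fst B \<Longrightarrow> reindex p j = reindex q j"
   "\<And>j. j \<in> fst B \<Longrightarrow> component p j = component q j"
  shows "p = q"
proof -
  have "reindex p = reindex q"
    by (rule PiE_ext[of _ "fst B" "\<lambda>_. fst A"]) (use assms in \<open>auto simp: in_hom_Maf\<close>)
  moreover have "component p = component q"
    by (rule extensionalityI[of _ "fst B"]) (use assms in \<open>auto simp: in_hom_Maf PiE_def\<close>)
  ultimately show ?thesis
    using assms(1,2) by (auto simp: in_hom_Maf intro: maf_arrow.expand)
qed

lemma prodE: assumes "k \<in> prod_set U I J" obtains i j where "k = pair U i j" "i \<in> I" "j \<in> J"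
  using assms by (auto simp: prod_set_def)
lemma prodI [simp]: "pair U i j \<in> prod_set U I J \<longleftrightarrow> i \<in> I \<and> j \<in> J"
  by (auto simp: prod_set_def) (metis proj1_pair, metis proj2_pair)

lemma maf_objD: "A \<in> maf_obj U C \<Longrightarrow> i \<in> fst A \<Longrightarrow> snd A i \<in> Obj C"
  by (cases A) (auto simp: maf_obj_def)
lemma tensor_maf_obj [simp]: "A \<in> maf_obj U C \<Longrightarrow> B \<in> maf_obj U C \<Longrightarrow> maf_tensor U C A B \<in> maf_obj U C"
  by (cases A; cases B) (auto simp: maf_obj_def maf_tensor_def small_prod elim!: prodE intro!: tensor_Obj)
lemma unit_maf_obj [simp]: "maf_unit U C \<in> maf_obj U C"
  by (auto simp: maf_obj_def maf_unit_def small_point unit_Obj)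

lemma fst_maf_tensor [simp]: "fst (maf_tensor U C A B) = prod_set U (fst A) (fst B)"
  by (simp add: maf_tensor_def)
lemma snd_maf_tensor [simp]: "i \<in> fst A \<Longrightarrow> j \<in> fst B \<Longrightarrow>
  snd (maf_tensor U C A B) (pair U i j) = snd A i \<otimes>\<^bsub>C\<^esub> snd B j"
  by (simp add: maf_tensor_def)
lemma maf_unit_simps [simp]: "fst (maf_unit U C) = {point U}" "snd (maf_unit U C) (point U) = \<I>\<^bsub>C\<^esub>"
  by (simp_all add: maf_unit_def)

lemma source_target [simp]:
  "source (maf_id C A) = A" "target (maf_id C A) = A"
  "source (maf_comp C q p) = source p" "target (maf_comp C q p) = target q"
  "source (maf_tensor_arr U C p q) = maf_tensor U C (source p) (source q)"
  "target (maf_tensor_arr U C p q) = maf_tensor U C (target p) (target q)"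
  "source (maf_associator U C A B D) = maf_tensor U C (maf_tensor U C A B) D"
  "target (maf_associator U C A B D) = maf_tensor U C A (maf_tensor U C B D)"
  "source (maf_left_unitor U C A) = maf_tensor U C (maf_unit U C) A"
  "target (maf_left_unitor U C A) = A"
  "source (maf_right_unitor U C A) = maf_tensor U C A (maf_unit U C)"
  "target (maf_right_unitor U C A) = A"
  by (simp_all add: maf_id_def maf_comp_def maf_tensor_arr_def Let_def maf_associator_def
     maf_left_unitor_def maf_right_unitor_def)

lemma reindex_component [simp]:
  "i \<in> fst A \<Longrightarrow> reindex (maf_id C A) i = i"
  "i \<in> fst A \<Longrightarrow> component (maf_id C A) i = Ident C (snd A i)"
  "k \<in> fst (target q) \<Longrightarrow> reindex (maf_comp C q p) k = reindex p (reindex q k)"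
  "k \<in> fst (target q) \<Longrightarrow> component (maf_comp C q p) k = component q k \<cdot>\<^bsub>C\<^esub> component p (reindex q k)"
  "i \<in> fst (target p) \<Longrightarrow> j \<in> fst (target q) \<Longrightarrow>
     reindex (maf_tensor_arr U C p q) (pair U i j) = pair U (reindex p i) (reindex q j)"
  "i \<in> fst (target p) \<Longrightarrow> j \<in> fst (target q) \<Longrightarrow>
     component (maf_tensor_arr U C p q) (pair U i j) = component p i \<odot>\<^bsub>C\<^esub> component q j"
  "i \<in> fst A \<Longrightarrow> j \<in> fst B \<Longrightarrow> k \<in> fst D \<Longrightarrow>
     reindex (maf_associator U C A B D) (pair U i (pair U j k)) = pair U (pair U i j) k"
  "i \<in> fst A \<Longrightarrow> j \<in> fst B \<Longrightarrow> k \<in> fst D \<Longrightarrow>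
     component (maf_associator U C A B D) (pair U i (pair U j k)) = associator C (snd A i) (snd B j) (snd D k)"
  "i \<in> fst A \<Longrightarrow> reindex (maf_left_unitor U C A) i = pair U (point U) i"
  "i \<in> fst A \<Longrightarrow> component (maf_left_unitor U C A) i = left_unitor C (snd A i)"
  "i \<in> fst A \<Longrightarrow> reindex (maf_right_unitor U C A) i = pair U i (point U)"
  "i \<in> fst A \<Longrightarrow> component (maf_right_unitor U C A) i = right_unitor C (snd A i)"
  by (simp_all add: maf_id_def maf_comp_def maf_tensor_arr_def Let_def maf_associator_def
     maf_left_unitor_def maf_right_unitor_def)

lemma reindex_component_extensional [simp]:
  "reindex (maf_id C A) \<in> extensional (fst A)"
  "component (maf_id C A) \<in> extensional (fst A)"
  "reindex (maf_comp C q p) \<in> extensional (fst (target q))"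
  "component (maf_comp C q p) \<in> extensional (fst (target q))"
  "reindex (maf_tensor_arr U C p q) \<in> extensional (prod_set U (fst (target p)) (fst (target q)))"
  "component (maf_tensor_arr U C p q) \<in> extensional (prod_set U (fst (target p)) (fst (target q)))"
  "reindex (maf_associator U C A B D) \<in> extensional (prod_set U (fst A) (prod_set U (fst B) (fst D)))"
  "component (maf_associator U C A B D) \<in> extensional (prod_set U (fst A) (prod_set U (fst B) (fst D)))"
  "reindex (maf_left_unitor U C A) \<in> extensional (fst A)"
  "component (maf_left_unitor U C A) \<in> extensional (fst A)"
  "reindex (maf_right_unitor U C A) \<in> extensional (fst A)"
  "component (maf_right_unitor U C A) \<in> extensional (fst A)"
  by (simp_all add: maf_id_def maf_comp_def maf_tensor_arr_def Let_def maf_associator_def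
     maf_left_unitor_def maf_right_unitor_def)

lemma constraint_homs: "X \<in> Obj C \<Longrightarrow> Y \<in> Obj C \<Longrightarrow> Z \<in> Obj C \<Longrightarrow> associator C X Y Z \<in> hom C ((X \<otimes>\<^bsub>C\<^esub> Y) \<otimes>\<^bsub>C\<^esub> Z) (X \<otimes>\<^bsub>C\<^esub> (Y \<otimes>\<^bsub>C\<^esub> Z))"
  "X \<in> Obj C \<Longrightarrow> left_unitor C X \<in> hom C (\<I>\<^bsub>C\<^esub> \<otimes>\<^bsub>C\<^esub> X) X"
  "X \<in> Obj C \<Longrightarrow> right_unitor C X \<in> hom C (X \<otimes>\<^bsub>C\<^esub> \<I>\<^bsub>C\<^esub>) X"
  using associator_iso left_unitor_iso right_unitor_iso by (auto simp: is_iso_def)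

lemma maf_id_hom: "A \<in> maf_obj U C \<Longrightarrow> maf_id C A \<in> hom (Maf U C) A A"
  by (rule Maf_homI) (auto intro: Id_hom maf_objD)
lemma maf_comp_hom: "p \<in> hom (Maf U C) A B \<Longrightarrow> q \<in> hom (Maf U C) B D \<Longrightarrow> maf_comp C q p \<in> hom (Maf U C) A D"
  using Maf_homD[of p A B] Maf_homD[of q B D] reindex_component_extensional(3,4)[of q p]
  by (intro Maf_homI) (auto intro!: Comp_hom)
lemma maf_tensor_arr_hom: "p \<in> hom (Maf U C) A A' \<Longrightarrow> q \<in> hom (Maf U C) B B' \<Longrightarrow>
  maf_tensor_arr U C p q \<in> hom (Maf U C) (maf_tensor U C A B) (maf_tensor U C A' B')"
  using Maf_homD[of p A A'] Maf_homD[of q B B'] reindex_component_extensional(5,6)[of p q]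
  by (intro Maf_homI) (auto elim!: prodE intro!: tensor_hom)
lemma maf_associator_hom: "A \<in> maf_obj U C \<Longrightarrow> B \<in> maf_obj U C \<Longrightarrow> D \<in> maf_obj U C \<Longrightarrow>
  maf_associator U C A B D \<in> hom (Maf U C) (maf_tensor U C (maf_tensor U C A B) D) (maf_tensor U C A (maf_tensor U C B D))"
  by (intro Maf_homI) (auto elim!: prodE intro!: maf_objD constraint_homs)
lemma maf_left_unitor_hom: "A \<in> maf_obj U C \<Longrightarrow> maf_left_unitor U C A \<in> hom (Maf U C) (maf_tensor U C (maf_unit U C) A) A"
  by (intro Maf_homI) (auto elim!: prodE intro!: maf_objD constraint_homs)
lemma maf_right_unitor_hom: "A \<in> maf_obj U C \<Longrightarrow> maf_right_unitor U C A \<in> hom (Maf U C) (maf_tensor U C A (maf_unit U C)) A"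
  by (intro Maf_homI) (auto elim!: prodE intro!: maf_objD constraint_homs)

lemma Maf_isoI:
  assumes p: "p \<in> hom (Maf U C) A B" and bij: "bij_betw (reindex p) (fst B) (fst A)"
    and iso: "\<And>j. j \<in> fst B \<Longrightarrow> is_iso C (snd A (reindex p j)) (snd B j) (component p j)"
  shows "is_iso (Maf U C) A B p"
proof -
  let ?r = "inv_into (fst B) (reindex p)"
  from iso obtain \<psi> where psi: "\<And>j. j \<in> fst B \<Longrightarrow> \<psi> j \<in> hom C (snd B j) (snd A (reindex p j)) \<and>
    \<psi> j \<cdot>\<^bsub>C\<^esub> component p j = Ident C (snd A (reindex p j)) \<and> component p j \<cdot>\<^bsub>C\<^esub> \<psi> j = Ident C (snd B j)"
    unfolding is_iso_def by metis
  define q where "q = Maf_Arrow B A (\<lambda>i\<in>fst A. ?r i) (\<lambda>i\<in>fst A. \<psi> (?r i))"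
  have r: "i \<in> fst A \<Longrightarrow> ?r i \<in> fst B \<and> reindex p (?r i) = i" for i
    using bij by (metis bij_betw_def f_inv_into_f inv_into_into)
  have l: "j \<in> fst B \<Longrightarrow> ?r (reindex p j) = j" for j
    using bij by (simp add: bij_betw_def)
  have q: "q \<in> hom (Maf U C) B A"
    by (rule Maf_homI) (use Maf_homD[OF p] r psi in \<open>force simp: q_def\<close>)+
  have "maf_comp C q p = maf_id C A"
    by (rule Maf_hom_eqI[OF maf_comp_hom[OF p q]maf_id_hom]) 
     (use Maf_homD[OF p] r psi in \<open>auto simp: q_def\<close>)
  moreover have "maf_comp C p q = maf_id C B"
    by (rule Maf_hom_eqI[OF maf_comp_hom[OF q p]maf_id_hom]) 
     (use Maf_homD[OF p] l psi in \<open>auto simp: q_def\<close>)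
  ultimately show ?thesis using p q by (auto simp: is_iso_def)
qed

lemma category_Maf: "category (Maf U C)"
proof (unfold_locales, goal_cases)
  case (1 f) then show ?case by (auto simp: maf_arr_def)
next
  case (2 f) then show ?case by (auto simp: maf_arr_def)
next
  case 3 then show ?case by (simp add: maf_id_hom)
next
  case 4 then show ?case by (simp add: maf_comp_hom)
next
  case (5 f X Y) note h = Maf_homD[OF 5]
  show ?case using h 5 by (intro Maf_hom_eqI[of _ X Y]) (auto intro!: maf_comp_hom maf_id_hom Id_left)
next
  case (6 f X Y) note h = Maf_homD[OF 6]
  show ?case using h 6 by (intro Maf_hom_eqI[of _ X Y]) (auto intro!: maf_comp_hom maf_id_hom Id_right)
next
  case (7 f W X g Y h Z) note h = Maf_homD[OF 7(1)] Maf_homD[OF 7(2)] Maf_homD[OF 7(3)]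
  show ?case using h 7 by (intro Maf_hom_eqI[of _ W Z]) (auto intro!: maf_comp_hom, metis Comp_assoc)
qed

lemma Maf_monoidal_category: "monoidal_category (Maf U C)"
proof (intro monoidal_category.intro monoidal_category_axioms.intro, goal_cases)
  case 1 show ?case by (rule category_Maf)
next case 2 then show ?case by simp
next case 3 then show ?case by simp
next case 4 then show ?case by (simp add: maf_tensor_arr_hom)
next case (5 X Y) then show ?case
    by (intro Maf_hom_eqI[of _ "maf_tensor U C X Y" "maf_tensor U C X Y"])
      (auto intro!: maf_tensor_arr_hom maf_id_hom tensor_Id maf_objD elim!: prodE)
next case (6 f X X' f' X'' g Y Y' g' Y'')
  note h = Maf_homD[OF 6(1)] Maf_homD[OF 6(2)] Maf_homD[OF 6(3)] Maf_homD[OF 6(4)]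
  show ?case using h 6
    by (intro Maf_hom_eqI[of _ "maf_tensor U C X Y" "maf_tensor U C X'' Y''"])
      (auto intro!: maf_tensor_arr_hom maf_comp_hom elim!: prodE, metis tensor_Comp)
next case (7 X Y Z) 
  have "is_iso (Maf U C) (maf_tensor U C (maf_tensor U C X Y) Z) (maf_tensor U C X (maf_tensor U C Y Z)) (maf_associator U C X Y Z)"
    using 7 by (intro Maf_isoI maf_associator_hom)
      (auto intro!: associator_iso maf_objD elim!: prodE simp: bij_betw_def inj_on_def image_iff Bex_def,
       (metis proj1_pair proj2_pair)+, (metis prodI reindex_component(7)))
  then show ?case by simp
next case (8 f X X' g Y Y' h Z Z')
  note h = Maf_homD[OF 8(1)] Maf_homD[OF 8(2)] Maf_homD[OF 8(3)]
  show ?case using h 8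
    by (intro Maf_hom_eqI[of _ "maf_tensor U C (maf_tensor U C X Y) Z" "maf_tensor U C X' (maf_tensor U C Y' Z')"])
      (auto intro!: maf_tensor_arr_hom maf_comp_hom maf_associator_hom associator_natural elim!: prodE)
next case (9 X)
  have "is_iso (Maf U C) (maf_tensor U C (maf_unit U C) X) X (maf_left_unitor U C X)"
    using 9 by (intro Maf_isoI maf_left_unitor_hom)
      (auto intro!: left_unitor_iso maf_objD elim!: prodE simp: bij_betw_def inj_on_def image_iff Bex_def,
       (metis proj1_pair proj2_pair)+)
  then show ?case by simp
next case (10 f X X')
  note h = Maf_homD[OF 10]
  show ?case using h 10
    by (intro Maf_hom_eqI[of _ "maf_tensor U C (maf_unit U C) X" X'])
      (auto intro!: maf_tensor_arr_hom maf_comp_hom maf_left_unitor_hom maf_id_hom left_unitor_natural elim!: prodE)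
next case (11 X)
  have "is_iso (Maf U C) (maf_tensor U C X (maf_unit U C)) X (maf_right_unitor U C X)"
    using 11 by (intro Maf_isoI maf_right_unitor_hom)
      (auto intro!: right_unitor_iso maf_objD elim!: prodE simp: bij_betw_def inj_on_def image_iff Bex_def,
       (metis proj1_pair proj2_pair)+)
  then show ?case by simp
next case (12 f X X')
  note h = Maf_homD[OF 12]
  show ?case using h 12
    by (intro Maf_hom_eqI[of _ "maf_tensor U C X (maf_unit U C)" X'])
      (auto intro!: maf_tensor_arr_hom maf_comp_hom maf_right_unitor_hom maf_id_hom right_unitor_natural elim!: prodE)
next case (13 X Y)
  show ?case using 13
    by (intro Maf_hom_eqI[of _ "maf_tensor U C (maf_tensor U C X (maf_unit U C)) Y" "maf_tensor U C X Y"])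
      (auto intro!: maf_tensor_arr_hom maf_comp_hom maf_right_unitor_hom maf_left_unitor_hom maf_associator_hom maf_id_hom triangle maf_objD elim!: prodE)
next case (14 W X Y Z)
  show ?case using 14
    by (intro Maf_hom_eqI[of _ "maf_tensor U C (maf_tensor U C (maf_tensor U C W X) Y) Z" "maf_tensor U C W (maf_tensor U C X (maf_tensor U C Y Z))"])
      (auto intro!: maf_tensor_arr_hom maf_comp_hom maf_associator_hom maf_id_hom pentagon maf_objD elim!: prodE)
qed

end

end

theory Submission
  imports Defs
begin

text \<open>
  The empty family \<open>X\<close> has no pre-dual: \<open>X' \<otimes> X\<close> is again empty, so an evaluation
  \<open>X' \<otimes> X \<rightarrow> \<I>\<close> would reindex along a map from a singleton to the empty set.
\<close>

theorem proposition3p4: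
  fixes U :: "'i universe_data"
    and C :: "('o, 'm) monoidal_data"
  assumes "set_universe U"
    and "monoidal_category C"
  shows "\<not> pre_rigid (Maf U C)"
proof
  assume rigid: "pre_rigid (Maf U C)"
  interpret maf U C
    using assms by (rule maf.intro)
  \<comment> \<open>Families are extensional, so over the empty index set the constant
    \<open>undefined\<close> function is the only one allowed: it is the sole element of
    \<open>{} \<rightarrow>\<^sub>E Obj C\<close>.\<close>
  define X :: "('i, 'o) family" where "X = ({}, \<lambda>_. undefined)"
  have "X \<in> Obj (Maf U C)"
    by (simp add: X_def maf_obj_def small_empty)
  with rigid obtain X' ev where "is_pre_dual (Maf U C) X X' ev"
    unfolding pre_rigid_def by blast
  then have "ev \<in> hom (Maf U C) (maf_tensor U C X' X) (maf_unit U C)"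
    by (simp add: is_pre_dual_def)
  \<comment> \<open>Reindexing is contravariant: it runs from the index set of the codomain, here
    the singleton of \<open>point U\<close>, back to that of the domain, a product with the empty
    factor \<open>fst X\<close>.\<close>
  then have "reindex ev (point U) \<in> prod_set U (fst X') {}"
    using Maf_homD(5) by (fastforce simp: X_def)
  then show False
    by (simp add: prod_set_def)
qed

end
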